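(* Let $\mathcal{A}$ be a finite alphabet of size at least $2$. Then $$\inf\{\, E^*(\mathbf{u}) \ :\ \mathbf{u}\in \mathcal{A}^{\mathbb{N}},\ \mathbf{u} \text{ uniformly recurrent}\,\} = 1 .$$ Consequently, $RT^*(d)=1$ for every integer $d\geq 2$, where $RT^*(d)=\inf\{E^*(\mathbf{u}) : \mathbf{u} \text{ is a sequence over a } d\text{-ary alphabet}\}$.
   Context: A sequence over a finite alphabet $\mathcal{A}$ is an infinite string $\mathbf{u}=u_0u_1u_2\cdots$ with $u_i\in\mathcal{A}$; $\mathcal{A}^{\mathbb{N}}$ is the set of all such sequences. A factor of $\mathbf{u}$ is a finite block $u_iu_{i+1}\cdots u_{j-1}$, $i\le j$, and $i$ is then an occurrence of it. $\mathbf{u}$ is uniformly recurrent if every factor of $\mathbf{u}$ occurs infinitely often and the distances between its consecutive occurrences are bounded. If $u$ is a non-empty word of length $\ell$ and $e=n/\ell$ is a positive rational number, $u^e$ denotes the prefix of length $n$ of the infinite periodic sequence $uuu\cdots$. The critical exponent is $E(\mathbf{u})=\sup\{e\in\mathbb{Q}: u^e \text{ is a factor of } \mathbf{u} \text{ for some non-empty word } u\}$. The asymptotic critical exponent $E^*(\mathbf{u})$ is $+\infty$ if $E(\mathbf{u})=+\infty$, and otherwise $E^*(\mathbf{u})=\limsup_{n\to\infty} e_n$, where $e_n=\sup\{e\in\mathbb{Q}: u^e \text{ is a factor of }\mathbf{u}\text{ for some word } u \text{ of length } n\}$. *)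

theory Defs
  imports Complex_Main "HOL-Library.Extended_Real" "HOL-Library.Liminf_Limsup"
begin

definition occurrence :: "'a list \<Rightarrow> (nat \<Rightarrow> 'a) \<Rightarrow> nat \<Rightarrow> bool" where
  "occurrence w u i \<longleftrightarrow> (\<exists>j\<ge>i. w = map u [i..<j])"

definition factor :: "'a list \<Rightarrow> (nat \<Rightarrow> 'a) \<Rightarrow> bool" where
  "factor w u \<longleftrightarrow> (\<exists>i. occurrence w u i)"

definition consecutive_occurrences :: "'a list \<Rightarrow> (nat \<Rightarrow> 'a) \<Rightarrow> nat \<Rightarrow> nat \<Rightarrow> bool" where
  "consecutive_occurrences w u i j \<longleftrightarrow>
     i < j \<and> occurrence w u i \<and> occurrence w u j \<and> (\<forall>k. i < k \<and> k < j \<longrightarrow> \<not> occurrence w u k)"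

definition uniformly_recurrent :: "(nat \<Rightarrow> 'a) \<Rightarrow> bool" where
  "uniformly_recurrent u \<longleftrightarrow>
     (\<forall>w. factor w u \<longrightarrow>
        infinite {i. occurrence w u i} \<and>
        (\<exists>B. \<forall>i j. consecutive_occurrences w u i j \<longrightarrow> j - i \<le> B))"

definition periodic_seq :: "'a list \<Rightarrow> nat \<Rightarrow> 'a" where
  "periodic_seq w i = w ! (i mod length w)"

text \<open>The fractional power of \<open>w\<close> with exponent \<open>e\<close>. It is only meaningful if \<open>w\<close> is non-empty,
  \<open>e\<close> is positive and \<open>e * length w\<close> is a natural number; these conditions are imposed where it
  is used, so the floor never actually rounds.\<close>

definition frac_power :: "'a list \<Rightarrow> rat \<Rightarrow> 'a list" where
  "frac_power w e = map (periodic_seq w) [0..<nat \<lfloor>e * of_nat (length w)\<rfloor>]"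

definition exponents :: "(nat \<Rightarrow> 'a) \<Rightarrow> 'a list \<Rightarrow> rat set" where
  "exponents u w =
     {e. w \<noteq> [] \<and> e > 0 \<and> e * of_nat (length w) \<in> \<nat> \<and> factor (frac_power w e) u}"

definition critical_exponent :: "(nat \<Rightarrow> 'a) \<Rightarrow> ereal" where
  "critical_exponent u = Sup {ereal (real_of_rat e) | e w. e \<in> exponents u w}"

text \<open>For \<open>n = 0\<close> the supremum below is over the empty set; this does not affect the limes superior.\<close>

definition max_exponent :: "(nat \<Rightarrow> 'a) \<Rightarrow> nat \<Rightarrow> ereal" where
  "max_exponent u n = Sup {ereal (real_of_rat e) | e w. length w = n \<and> e \<in> exponents u w}"

definition asymptotic_critical_exponent :: "(nat \<Rightarrow> 'a) \<Rightarrow> ereal" where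
  "asymptotic_critical_exponent u =
     (if critical_exponent u = \<infinity> then \<infinity> else limsup (max_exponent u))"

text \<open>Up to renaming of letters, every \<open>d\<close>-ary alphabet is a set of \<open>d\<close> natural numbers.\<close>

definition RT_star :: "nat \<Rightarrow> ereal" where
  "RT_star d =
     Inf {asymptotic_critical_exponent u | (u :: nat \<Rightarrow> nat) A.
            finite A \<and> card A = d \<and> range u \<subseteq> A}"

end

theory Submission
  imports Defs
begin

text \<open>
  The infimum is approached by Toeplitz words. Fix \<open>Q = 2 ^ k\<close> and let the letter at a position
  \<open>4 m\<close>, \<open>m = 2 ^ j * r\<close> with \<open>r\<close> odd, be the \<open>k\<close>-th binary digit of \<open>r\<close>; the remaining
  positions carry a single mark per period \<open>4 Q\<close>. A shift by \<open>p\<close> that is not a multiple of \<open>4 Q\<close>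
  moves some mark within every window of length \<open>4 Q\<close>. If \<open>p = 4 * 2 ^ j * Q * s\<close> with
  \<open>s\<close> odd, the shift flips the letter at \<^emph>\<open>every\<close> position \<open>4 * 2 ^ j * r\<close> with \<open>r\<close> odd, and such a
  position lies in every window of length \<open>8 * 2 ^ j \<le> 2 p / Q\<close>. Hence a factor of period \<open>p\<close> has
  exponent at most \<open>1 + 2 / Q + 4 Q / p\<close>. Every position except \<open>0\<close> is repeated periodically,
  so the word is uniformly recurrent once its first letter is dropped.
\<close>

section \<open>Binary digits of odd parts and the Toeplitz sequence\<close>

definition odd_part_digit :: "nat \<Rightarrow> nat \<Rightarrow> bool" where
  "odd_part_digit k m \<longleftrightarrow> (\<exists>j r. odd r \<and> m = 2 ^ j * r \<and> odd (r div 2 ^ k))"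

definition toeplitz :: "nat \<Rightarrow> nat \<Rightarrow> bool" where
  "toeplitz k n = (if 4 dvd n then odd_part_digit k (n div 4) else n mod (4 * 2 ^ k) = 1)"

lemma odd_decomposition:
  fixes n :: nat
  assumes "n > 0"
  obtains j r where "odd r" "n = 2 ^ j * r"
  using assms
proof (induction n arbitrary: thesis rule: less_induct)
  case (less n)
  show ?case
  proof (cases "odd n")
    case True
    then show ?thesis using less.prems(1)[of n 0] by simp
  next
    case False
    then obtain m where m: "n = 2 * m" by blast
    with less.prems(2) have "m < n" "m > 0" by auto
    then obtain j r where "odd r" "m = 2 ^ j * r" using less.IH by blast
    then show ?thesis using less.prems(1)[of r "Suc j"] m by simp
  qed
qed

lemma odd_decomposition_unique:
  fixes r s :: nat
  assumes "odd r" "odd s" "2 ^ i * r = 2 ^ j * s"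
  shows "i = j \<and> r = s"
  using assms(3)
proof (induction i arbitrary: j)
  case 0
  then show ?case using assms(1) by (cases j) auto
next
  case (Suc i)
  then show ?case using assms(2) by (cases j) auto
qed

lemma odd_part_digit_iff:
  assumes "odd r"
  shows "odd_part_digit k (2 ^ j * r) \<longleftrightarrow> odd (r div 2 ^ k)"
  unfolding odd_part_digit_def using assms odd_decomposition_unique by blast

text \<open>Factoring out \<open>2 ^ j\<close> leaves \<open>r + 2 ^ k * s\<close>, which is still
  odd because \<open>k > 0\<close>, and its quotient by \<open>2 ^ k\<close> grows by exactly
  \<open>s\<close>. So even \<open>s\<close> preserves the digit and odd \<open>s\<close> flips
  it.\<close>

lemma odd_part_digit_shift:
  assumes "odd r" "k > 0"
  shows "odd_part_digit k (2 ^ j * r + 2 ^ j * 2 ^ k * s) \<longleftrightarrow> odd (r div 2 ^ k + s)"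
proof -
  have "odd (r + 2 ^ k * s)" using assms by simp
  then have "odd_part_digit k (2 ^ j * (r + 2 ^ k * s)) \<longleftrightarrow> odd ((r + 2 ^ k * s) div 2 ^ k)"
    by (rule odd_part_digit_iff)
  then show ?thesis by (simp add: algebra_simps)
qed

lemma toeplitz_mult_4: "toeplitz k (4 * m) \<longleftrightarrow> odd_part_digit k m"
  by (simp add: toeplitz_def)

text \<open>If \<open>n = 4 * 2 ^ j * r\<close> with \<open>r\<close> odd, then
  \<open>n < 2 ^ J\<close> forces \<open>j < J\<close>, so the shift is an even multiple of
  \<open>4 * 2 ^ j * 2 ^ k\<close> and keeps the digit. Off the multiples of 4 the mark period
  \<open>4 * 2 ^ k\<close> divides the shift. Position 0 has no odd part and is excluded.\<close>

lemma toeplitz_periodic: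
  assumes "k > 0" "0 < n" "n < 2 ^ J"
  shows "toeplitz k (n + t * (8 * 2 ^ J * 2 ^ k)) = toeplitz k n"
proof (cases "4 dvd n")
  case True
  then obtain m where m: "n = 4 * m" by blast
  with assms(2) have "m > 0" by simp
  then obtain j r where r: "odd r" "m = 2 ^ j * r"
    by (rule odd_decomposition)
  have "r > 0" using r(1) by (cases r) auto
  then have "2 ^ j \<le> m" using r(2) by simp
  then have "(2::nat) ^ j < 2 ^ J" using m assms(3) by linarith
  then have "j < J" by simp
  then have J: "(2::nat) ^ J = 2 ^ j * 2 ^ (J - j)"
    by (simp flip: power_add)
  have P: "n + t * (8 * 2 ^ J * 2 ^ k) = 4 * (2 ^ j * r + 2 ^ j * 2 ^ k * (2 * 2 ^ (J - j) * t))"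
    using m r(2) J by (simp add: algebra_simps)
  have n: "n = 4 * (2 ^ j * r)" using m r(2) by simp
  have "toeplitz k (n + t * (8 * 2 ^ J * 2 ^ k)) \<longleftrightarrow> odd (r div 2 ^ k + 2 * 2 ^ (J - j) * t)"
    unfolding P toeplitz_mult_4 by (rule odd_part_digit_shift[OF r(1) assms(1)])
  also have "\<dots> \<longleftrightarrow> odd (r div 2 ^ k)" by simp
  also have "\<dots> \<longleftrightarrow> toeplitz k n"
    unfolding n toeplitz_mult_4 by (rule odd_part_digit_iff[OF r(1), symmetric])
  finally show ?thesis .
next
  case False
  have P: "t * (8 * 2 ^ J * 2 ^ k) = (4 * 2 ^ k) * (2 * 2 ^ J * t)"
    by simp
  have "4 dvd t * (8 * 2 ^ J * 2 ^ k)" by (simp add: P)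
  then have "\<not> 4 dvd n + t * (8 * 2 ^ J * 2 ^ k)"
    using False by (metis dvd_add_left_iff)
  moreover have "(n + t * (8 * 2 ^ J * 2 ^ k)) mod (4 * 2 ^ k) = n mod (4 * 2 ^ k)"
    unfolding P by (rule mod_mult_self2)
  ultimately show ?thesis using False by (simp add: toeplitz_def)
qed

section \<open>Mismatches between the sequence and its shifts\<close>

lemma residue_in_window:
  fixes m s r :: nat
  assumes "m > 0"
  shows "\<exists>t<m. (s + t) mod m = r mod m"
proof -
  \<comment> \<open>This is \<open>r - s\<close> modulo \<open>m\<close>; \<open>m - s mod m\<close>
    plays the role of \<open>-s\<close> in the naturals.\<close>
  define t where "t = (r + (m - s mod m)) mod m"
  have "(s + t) mod m = (s mod m + (r + (m - s mod m))) mod m"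
    by (simp add: t_def mod_simps)
  also have "s mod m + (r + (m - s mod m)) = r + m"
    using mod_less_divisor[OF assms, of s] by linarith
  finally show ?thesis using assms by (intro exI[of _ t]) (simp add: t_def)
qed

lemma toeplitz_mark_mismatch:
  assumes "\<not> 4 * 2 ^ k dvd p"
  shows "\<exists>t<4 * 2 ^ k. toeplitz k (s + t) \<noteq> toeplitz k (s + t + p)"
proof -
  define M :: nat where "M = 4 * 2 ^ k"
  have M: "M > 0" "4 dvd M" "M \<noteq> 1" by (auto simp: M_def)
  have mod4: "a mod 4 = b mod 4" if "a mod M = b mod M" for a b
    using that M(2) by (metis mod_mod_cancel)
  have mark: "toeplitz k a" if "a mod M = 1" for a
  proof -
    have "1 mod M = 1" using M by auto
    then have "a mod 4 = 1" using mod4[of a 1] that by simp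
    then have "\<not> 4 dvd a" by presburger
    then show ?thesis using that by (simp add: toeplitz_def M_def)
  qed
  have one: "1 mod M = 1" using M by auto
  have no_mark: "\<not> toeplitz k a" if "\<not> 4 dvd a" "a mod M \<noteq> 1" for a
    using that by (simp add: toeplitz_def M_def)
  have shift: "\<not> ((s + t) mod M = 1 \<and> (s + t + p) mod M = 1)" for t
  proof
    assume "(s + t) mod M = 1 \<and> (s + t + p) mod M = 1"
    then have "(s + t + p) mod M = (s + t) mod M" by simp
    then have "M dvd s + t + p - (s + t)"
      by (metis le_add1 mod_eq_dvd_iff_nat)
    then show False using assms by (simp add: M_def)
  qed
  have "\<exists>t<M. toeplitz k (s + t) \<noteq> toeplitz k (s + t + p)"
  \<comment> \<open>A mark never lands on a mark, but for \<open>p mod 4 = 3\<close> it lands on a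
    multiple of 4, where the letter is not controlled. In that case take a mark in the shifted
    window instead: it comes from a position that is 2 modulo 4 and unmarked.\<close>
  proof (cases "p mod 4 = 3")
    case False
    obtain t where t: "t < M" "(s + t) mod M = 1"
      using residue_in_window[OF M(1), of s 1] one by auto
    have "(s + t) mod 4 = 1" using mod4[of "s + t" 1] t(2) one by simp
    with False have "\<not> 4 dvd s + t + p" by presburger
    then have "\<not> toeplitz k (s + t + p)" using no_mark shift t(2) by blast
    then show ?thesis using mark[OF t(2)] t(1) by blast
  next
    case True
    obtain t where t: "t < M" "(s + p + t) mod M = 1"
      using residue_in_window[OF M(1), of "s + p" 1] one by auto
    then have t': "(s + t + p) mod M = 1" by (simp add: ac_simps)
    have "(s + t + p) mod 4 = 1" using mod4[of "s + t + p" 1] t' one by simp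
    with True have "\<not> 4 dvd s + t" by presburger
    then have "\<not> toeplitz k (s + t)" using no_mark shift t' by blast
    then show ?thesis using mark[OF t'] t(1) by blast
  qed
  then show ?thesis by (simp add: M_def)
qed

lemma toeplitz_digit_mismatch:
  assumes "k > 0" "odd q" "p = 4 * (2 ^ j * 2 ^ k * q)"
  shows "\<exists>t<8 * 2 ^ j. toeplitz k (s + t) \<noteq> toeplitz k (s + t + p)"
proof -
  \<comment> \<open>The class of \<open>4 * 2 ^ j\<close> modulo \<open>8 * 2 ^ j\<close> consists
    of the positions \<open>4 * 2 ^ j * r\<close> with \<open>r\<close> odd.\<close>
  obtain t where t: "t < 8 * 2 ^ j" "(s + t) mod (8 * 2 ^ j) = 4 * 2 ^ j"
    using residue_in_window[of "8 * 2 ^ j" s "4 * 2 ^ j"] by auto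
  define b where "b = (s + t) div (8 * 2 ^ j)"
  have "s + t = 8 * 2 ^ j * b + 4 * 2 ^ j"
    using t(2) by (metis b_def mult_div_mod_eq)
  then have n: "s + t = 4 * (2 ^ j * (2 * b + 1))" by (simp add: algebra_simps)
  then have np: "s + t + p = 4 * (2 ^ j * (2 * b + 1) + 2 ^ j * 2 ^ k * q)"
    using assms(3) by simp
  have o: "odd (2 * b + 1)" by simp
  have "toeplitz k (s + t) \<longleftrightarrow> odd ((2 * b + 1) div 2 ^ k)"
    unfolding n toeplitz_mult_4 by (rule odd_part_digit_iff[OF o])
  moreover have "toeplitz k (s + t + p) \<longleftrightarrow> odd ((2 * b + 1) div 2 ^ k + q)"
    unfolding np toeplitz_mult_4 by (rule odd_part_digit_shift[OF o assms(1)])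
  ultimately show ?thesis using t(1) assms(2) by auto
qed

text \<open>The bound is \<open>t \<le> 4 * 2 ^ k + 2 * p / 2 ^ k\<close>, multiplied by
  \<open>2 ^ k\<close> to stay in the naturals. The first summand covers the mark mismatch, the
  second the digit mismatch.\<close>

lemma toeplitz_mismatch:
  assumes "k > 0" "p > 0"
  shows "\<exists>t. t * 2 ^ k \<le> 4 * 2 ^ k * 2 ^ k + 2 * p \<and> toeplitz k (s + t) \<noteq> toeplitz k (s + t + p)"
proof (cases "4 * 2 ^ k dvd p")
  case False
  then obtain t where "t < 4 * 2 ^ k" "toeplitz k (s + t) \<noteq> toeplitz k (s + t + p)"
    using toeplitz_mark_mismatch by blast
  moreover from this have "t * 2 ^ k \<le> 4 * 2 ^ k * 2 ^ k" by simp
  ultimately show ?thesis by (intro exI[of _ t] conjI trans_le_add1)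
next
  case True
  then obtain p' where p': "p = 4 * 2 ^ k * p'" by blast
  with assms have "p' > 0" by simp
  then obtain j q where q: "odd q" "p' = 2 ^ j * q"
    by (rule odd_decomposition)
  have p: "p = 4 * (2 ^ j * 2 ^ k * q)" using p' q by simp
  obtain t where t: "t < 8 * 2 ^ j" "toeplitz k (s + t) \<noteq> toeplitz k (s + t + p)"
    using toeplitz_digit_mismatch[OF assms(1) q(1) p] by blast
  have "q \<ge> 1" using q(1) by (cases q) auto
  have "t * 2 ^ k \<le> 8 * 2 ^ j * 2 ^ k" using t(1) by simp
  also have "\<dots> \<le> 8 * 2 ^ j * 2 ^ k * q" using \<open>q \<ge> 1\<close> by simp
  also have "\<dots> = 2 * p" using p by simp
  finally show ?thesis using t(2) by (intro exI[of _ t]) simp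
qed

section \<open>Exponents of factors of the Toeplitz words\<close>

lemma occurrence_iff: "occurrence w u i \<longleftrightarrow> (\<forall>t<length w. u (i + t) = w ! t)"
proof
  assume "occurrence w u i"
  then show "\<forall>t<length w. u (i + t) = w ! t" by (auto simp: occurrence_def)
next
  assume *: "\<forall>t<length w. u (i + t) = w ! t"
  have "w = map u [i..<i + length w]"
    by (rule nth_equalityI) (auto simp: *)
  then show "occurrence w u i" unfolding occurrence_def by (metis le_add1)
qed

text \<open>Reduces a fractional power to what the estimate uses: a block of length \<open>l\<close>
  starting at \<open>i\<close> with period \<open>length w\<close>.\<close>

lemma exponentsE:
  assumes "e \<in> exponents u w"
  obtains i l where "w \<noteq> []" "real_of_rat e * real (length w) = real l"
    "\<And>t. t + length w < l \<Longrightarrow> u (i + t) = u (i + t + length w)"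
proof -
  from assms have w: "w \<noteq> []" and fac: "factor (frac_power w e) u"
    and nat: "e * of_nat (length w) \<in> \<nat>"
    by (auto simp: exponents_def)
  obtain l where l: "e * of_nat (length w) = of_nat l" using nat by (auto elim: Nats_cases)
  have "real_of_rat (e * of_nat (length w)) = real_of_rat (of_nat l)" using l by simp
  then have rl: "real_of_rat e * real (length w) = real l" by (simp add: of_rat_mult)
  have fp: "frac_power w e = map (periodic_seq w) [0..<l]" by (simp add: frac_power_def l)
  obtain i where i: "\<And>t. t < l \<Longrightarrow> u (i + t) = periodic_seq w t"
    using fac by (auto simp: factor_def occurrence_iff fp)
  have "u (i + t) = u (i + t + length w)" if "t + length w < l" for t
    using i[of t] i[of "t + length w"] that by (simp add: periodic_seq_def add.assoc)
  then show thesis using that w rl by blast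
qed

text \<open>\<open>Suc n\<close> drops position 0, the only one not covered by
  \<open>toeplitz_periodic\<close>.\<close>

definition toeplitz_word :: "'a \<Rightarrow> 'a \<Rightarrow> nat \<Rightarrow> nat \<Rightarrow> 'a" where
  "toeplitz_word a b k n = (if toeplitz k (Suc n) then a else b)"

text \<open>A mismatch at offset \<open>t\<close> breaks the period, so the block has length at most
  \<open>t + length w\<close>; dividing by \<open>length w\<close> turns the bound on
  \<open>t\<close> into one on the exponent.\<close>

lemma exponent_toeplitz_word:
  assumes "a \<noteq> b" "k > 0" "e \<in> exponents (toeplitz_word a b k) w"
  shows "w \<noteq> []" "real_of_rat e \<le> 1 + 2 / 2 ^ k + 4 * 2 ^ k / real (length w)"
proof -
  obtain i l where w: "w \<noteq> []" and l: "real_of_rat e * real (length w) = real l"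
    and per: "\<And>t. t + length w < l \<Longrightarrow>
      toeplitz_word a b k (i + t) = toeplitz_word a b k (i + t + length w)"
    using exponentsE[OF assms(3)] by blast
  show "w \<noteq> []" by fact
  let ?n = "length w"
  obtain t where t: "t * 2 ^ k \<le> 4 * 2 ^ k * 2 ^ k + 2 * ?n"
    and ne: "toeplitz k (Suc i + t) \<noteq> toeplitz k (Suc i + t + ?n)"
    using toeplitz_mismatch[OF assms(2), of ?n "Suc i"] w by auto
  from ne have "toeplitz_word a b k (i + t) \<noteq> toeplitz_word a b k (i + t + ?n)"
    using assms(1) by (auto simp: toeplitz_word_def)
  with per have "l \<le> t + ?n" by (meson not_le)
  moreover have "real t \<le> 4 * 2 ^ k + 2 * real ?n / 2 ^ k"
  proof -
    have "real (t * 2 ^ k) \<le> real (4 * 2 ^ k * 2 ^ k + 2 * ?n)" using t by (rule of_nat_mono)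
    then show ?thesis by (simp add: field_simps)
  qed
  ultimately have "real_of_rat e * real ?n \<le> real ?n + 4 * 2 ^ k + 2 * real ?n / 2 ^ k"
    using l by linarith
  then have "real_of_rat e \<le> (real ?n + 4 * 2 ^ k + 2 * real ?n / 2 ^ k) / real ?n"
    using w by (simp add: pos_le_divide_eq)
  also have "\<dots> = 1 + 2 / 2 ^ k + 4 * 2 ^ k / real ?n"
    using w by (simp add: field_simps)
  finally show "real_of_rat e \<le> 1 + 2 / 2 ^ k + 4 * 2 ^ k / real ?n" .
qed

lemma asymptotic_critical_exponent_toeplitz_word:
  assumes "a \<noteq> b" "k > 0"
  shows "asymptotic_critical_exponent (toeplitz_word a b k) \<le> ereal (1 + 2 / 2 ^ k)"
proof -
  let ?u = "toeplitz_word a b k"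
  \<comment> \<open>The crude bound from \<open>length w \<ge> 1\<close> rules out the infinite
    branch of the definition.\<close>
  have "critical_exponent ?u \<le> ereal (1 + 2 / 2 ^ k + 4 * 2 ^ k)"
    unfolding critical_exponent_def
  proof (rule Sup_least, clarsimp)
    fix e w assume e: "e \<in> exponents ?u w"
    have "real (length w) \<ge> 1"
      using exponent_toeplitz_word(1)[OF assms e] by (cases w) auto
    then have "4 * 2 ^ k / real (length w) \<le> 4 * 2 ^ k"
      by (simp add: divide_le_eq)
    then show "real_of_rat e \<le> 1 + 2 / 2 ^ k + 4 * 2 ^ k"
      using exponent_toeplitz_word(2)[OF assms e] by linarith
  qed
  then have fin: "critical_exponent ?u \<noteq> \<infinity>" by auto
  let ?f = "\<lambda>n. ereal (1 + 2 / 2 ^ k + 4 * 2 ^ k / real n)"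
  have "max_exponent ?u n \<le> ?f n" for n
    unfolding max_exponent_def
    using exponent_toeplitz_word(2)[OF assms] by (intro Sup_least) auto
  then have "limsup (max_exponent ?u) \<le> limsup ?f"
    by (intro Limsup_mono) simp
  also have "\<dots> = ereal (1 + 2 / 2 ^ k)"
  proof (rule lim_imp_Limsup)
    have "(\<lambda>n. 1 + 2 / 2 ^ k + 4 * 2 ^ k / real n) \<longlonglongrightarrow> 1 + 2 / 2 ^ k + 0"
      by (intro tendsto_intros lim_const_over_n)
    then show "?f \<longlonglongrightarrow> ereal (1 + 2 / 2 ^ k)" by simp
  qed simp
  finally show ?thesis using fin by (simp add: asymptotic_critical_exponent_def)
qed

section \<open>Uniform recurrence\<close>

lemma uniformly_recurrent_toeplitz_word:
  assumes "k > 0"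
  shows "uniformly_recurrent (toeplitz_word a b k)"
  unfolding uniformly_recurrent_def
proof (intro allI impI)
  let ?u = "toeplitz_word a b k"
  fix w assume "factor w ?u"
  then obtain i where i: "occurrence w ?u i" by (auto simp: factor_def)
  \<comment> \<open>Every position \<open>Suc (i + x)\<close> of the occurrence lies below
    \<open>J\<close>, hence below \<open>2 ^ J\<close>, so one period \<open>P\<close> serves all
    its letters.\<close>
  define J where "J = Suc (i + length w)"
  define P :: nat where "P = 8 * 2 ^ J * 2 ^ k"
  have "P > 0" by (simp add: P_def)
  have occ: "occurrence w ?u (i + t * P)" for t
    unfolding occurrence_iff
  proof (intro allI impI)
    fix x assume x: "x < length w"
    have "J < 2 ^ J" by (rule less_exp)
    then have "Suc (i + x) < 2 ^ J" using x by (simp add: J_def)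
    then have "toeplitz k (Suc (i + x) + t * P) = toeplitz k (Suc (i + x))"
      unfolding P_def by (intro toeplitz_periodic assms) auto
    then have "?u (i + t * P + x) = ?u (i + x)" by (simp add: toeplitz_word_def add_ac)
    then show "?u (i + t * P + x) = w ! x" using i x by (simp add: occurrence_iff)
  qed
  have "infinite (range (\<lambda>t. i + t * P))"
    using \<open>P > 0\<close> by (intro range_inj_infinite) (auto simp: inj_def)
  then have "infinite {i. occurrence w ?u i}"
    by (rule contrapos_nn) (erule finite_subset[rotated], use occ in auto)
  moreover have "m - n \<le> i + P" if "consecutive_occurrences w ?u n m" for n m
  proof (rule ccontr)
    assume "\<not> m - n \<le> i + P"
    then have m: "n + i + P < m" by simp
    \<comment> \<open>The known occurrences start at \<open>i\<close>, so the first multiple of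
      \<open>P\<close> beyond \<open>n\<close> is moved by \<open>i\<close>; this costs the extra
      \<open>i\<close> in the gap bound.\<close>
    define o' where "o' = i + Suc (n div P) * P"
    have "n < Suc (n div P) * P" "Suc (n div P) * P \<le> n + P"
      using \<open>P > 0\<close> by (auto simp: dividend_less_div_times)
    then have "n < o'" "o' < m" using m unfolding o'_def by linarith+
    moreover have "occurrence w ?u o'" unfolding o'_def by (rule occ)
    ultimately show False using that by (auto simp: consecutive_occurrences_def)
  qed
  ultimately show "infinite {i. occurrence w ?u i} \<and>
      (\<exists>B. \<forall>n m. consecutive_occurrences w ?u n m \<longrightarrow> m - n \<le> B)"
    by blast
qed

section \<open>The lower bound and the infimum\<close>

lemma one_le_asymptotic_critical_exponent: "1 \<le> asymptotic_critical_exponent u"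
proof -
  have "1 \<le> max_exponent u n" if "n > 0" for n
  proof -
    \<comment> \<open>The prefix of length \<open>n\<close> is its own first power, which gives
      exponent 1 for every positive length.\<close>
    let ?w = "map u [0..<n]"
    have "frac_power ?w 1 = ?w"
      by (rule nth_equalityI) (auto simp: frac_power_def periodic_seq_def)
    moreover have "factor ?w u" by (auto simp: factor_def occurrence_def)
    ultimately have "1 \<in> exponents u ?w" using that by (auto simp: exponents_def)
    then have "ereal (real_of_rat 1) \<le> max_exponent u n"
      unfolding max_exponent_def by (intro Sup_upper) force
    then show ?thesis by (simp add: one_ereal_def)
  qed
  then have "1 \<le> limsup (max_exponent u)"
    by (intro le_Limsup) (auto simp: eventually_sequentially intro!: exI[of _ 1])
  then show ?thesis by (simp add: asymptotic_critical_exponent_def)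
qed

text \<open>Stated for an arbitrary set \<open>S\<close> of values so that it yields both infima of
  the theorem. The bounds \<open>1 + 2 / 2 ^ k\<close> tend to 1 as \<open>k\<close> grows.\<close>

lemma Inf_asymptotic_critical_exponent:
  assumes "S \<subseteq> range asymptotic_critical_exponent" "a \<noteq> b"
    and "\<And>k. k > 0 \<Longrightarrow> asymptotic_critical_exponent (toeplitz_word a b k) \<in> S"
  shows "Inf S = 1"
proof (rule antisym)
  show "1 \<le> Inf S"
    using assms(1) one_le_asymptotic_critical_exponent by (intro Inf_greatest) auto
  have "(\<lambda>k. 1 + 2 * (1 / 2) ^ k :: real) \<longlonglongrightarrow> 1 + 2 * 0"
    by (intro tendsto_intros LIMSEQ_power_zero) simp
  then have "(\<lambda>k. ereal (1 + 2 / 2 ^ k)) \<longlonglongrightarrow> 1"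
    by (simp add: one_ereal_def power_divide)
  moreover have "Inf S \<le> ereal (1 + 2 / 2 ^ k)" if "k \<ge> 1" for k
    using assms(2,3) asymptotic_critical_exponent_toeplitz_word[of a b k] that
    by (intro order_trans[OF Inf_lower]) auto
  ultimately show "Inf S \<le> 1"
    by (blast intro: LIMSEQ_le_const)
qed

theorem theorem3:
  "(\<forall>A :: 'a set. finite A \<and> card A \<ge> 2 \<longrightarrow>
      Inf {asymptotic_critical_exponent u | u. range u \<subseteq> A \<and> uniformly_recurrent u} = 1)
   \<and> (\<forall>d\<ge>2. RT_star d = 1)"
proof (intro conjI allI impI)
  fix A :: "'a set"
  assume "finite A \<and> card A \<ge> 2"
  then obtain a b where "a \<in> A" "b \<in> A" "a \<noteq> b"
    by (metis card_le_Suc0_iff_eq not_less_eq_eq numeral_2_eq_2)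
  then show "Inf {asymptotic_critical_exponent u | u. range u \<subseteq> A \<and> uniformly_recurrent u} = 1"
    by (intro Inf_asymptotic_critical_exponent[of _ a b])
      (auto intro!: exI[of _ "toeplitz_word a b _"] uniformly_recurrent_toeplitz_word
        simp: toeplitz_word_def[abs_def])
next
  fix d :: nat
  assume d: "d \<ge> 2"
  show "RT_star d = 1"
    unfolding RT_star_def
  proof (rule Inf_asymptotic_critical_exponent[of _ "0::nat" 1])
    fix k :: nat
    \<comment> \<open>\<open>{..<d}\<close> serves as the alphabet with \<open>d\<close> letters; it
      contains 0 and 1 because \<open>d \<ge> 2\<close>.\<close>
    have "range (toeplitz_word 0 1 k) \<subseteq> {..<d}"
      using d by (auto simp: toeplitz_word_def)
    then show "asymptotic_critical_exponent (toeplitz_word (0::nat) 1 k) \<in>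
        {asymptotic_critical_exponent u | (u :: nat \<Rightarrow> nat) A. finite A \<and> card A = d \<and> range u \<subseteq> A}"
      by (intro CollectI exI[of _ "toeplitz_word 0 1 k"] exI[of _ "{..<d}"] conjI refl) auto
  qed auto
qed

end
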